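(* Let $k\ge 2$ be a fixed integer. There exists a constant $L_0$ (depending only on $k$) such that for every constant $L\ge L_0$, if $m=Ln\log n$, then $$\lim_{n\to\infty}\Pr\left[H^{(n)}_{kn,m,k}\text{ contains a rainbow perfect matching}\right]=1.$$
   Context: The random edge-colored $k$-uniform hypergraph $H^{(n)}_{kn,m,k}$ has vertex set $[kn]=\{1,\dots,kn\}$; its edge set is a uniformly random $m$-element subset of the set $\binom{[kn]}{k}$ of all $k$-element subsets of $[kn]$, and each edge independently receives a uniformly random color from $[n]=\{1,\dots,n\}$. A perfect matching is a set of pairwise disjoint edges whose union is $[kn]$ (so it has $n$ edges). A set of edges is rainbow if its edges have pairwise different colors. Here $\log$ is the natural logarithm, and $m=Ln\log n$ is understood to be rounded to an integer, i.e. $m=\lceil Ln\log n\rceil$. *)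

theory Defs
  imports "HOL-Probability.Probability"
begin

definition k_subsets :: "nat \<Rightarrow> nat \<Rightarrow> nat set set" where
  "k_subsets N k = {e. e \<subseteq> {1..N} \<and> card e = k}"

(* An edge-coloured hypergraph is a pair (E, c) of its edge set and its colouring; c is
   meaningful only on E, and has the dummy value 0, which is not a colour, outside E.
   The definition is meaningful only if n > 0 and m is at most the number of k-subsets;
   otherwise pmf_of_set is applied to an empty set and is unspecified. *)
definition random_coloured_hypergraph ::
    "nat \<Rightarrow> nat \<Rightarrow> nat \<Rightarrow> nat \<Rightarrow> (nat set set \<times> (nat set \<Rightarrow> nat)) pmf" where
  "random_coloured_hypergraph n N m k =
     do {
       E \<leftarrow> pmf_of_set {E. E \<subseteq> k_subsets N k \<and> card E = m};
       c \<leftarrow> Pi_pmf E 0 (\<lambda>_. pmf_of_set {1..n});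
       return_pmf (E, c)
     }"

definition perfect_matching :: "nat \<Rightarrow> nat set set \<Rightarrow> bool" where
  "perfect_matching N M \<longleftrightarrow> disjoint M \<and> \<Union>M = {1..N}"

definition rainbow :: "(nat set \<Rightarrow> nat) \<Rightarrow> nat set set \<Rightarrow> bool" where
  "rainbow c M \<longleftrightarrow> inj_on c M"

definition has_rainbow_perfect_matching ::
    "nat \<Rightarrow> nat set set \<times> (nat set \<Rightarrow> nat) \<Rightarrow> bool" where
  "has_rainbow_perfect_matching N H \<longleftrightarrow>
     (\<exists>M. M \<subseteq> fst H \<and> perfect_matching N M \<and> rainbow (snd H) M)"

end

theory Submission
  imports Defs "HOL-Real_Asymp.Real_Asymp"
begin

text \<open>Why the theorem holds. A rainbow perfect matching is a set of \<open>n\<close> pairs (edge, colour) in which the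
edges partition the vertices and each colour occurs once. These sets form a \<^emph>\<open>spread\<close> family: among them,
the proportion that contains a given set of \<open>t\<close> pairs is at most \<open>\<sigma> ^ t\<close> with
\<open>\<sigma> = k! (e / (k n)) ^ k\<close> (\<open>coloured_matchings_spread\<close>). A random subset of a ground set whose
density is a large multiple of \<open>\<sigma> * log n\<close> contains a member of such a family with high probability
(\<open>spread_family_covered\<close>); this is the theorem of Frankston, Kahn, Narayanan and Park, proved here with
the minimum fragments of Park and Pham. The random set is exposed in about \<open>log n\<close> rounds, and each
round halves the part of the members that is still to be covered. Most members survive a round because a
pair of a member and a random set that leaves a large uncovered part has a cheap encoding
(\<open>fragment_round\<close>). Giving the late rounds, which have little left to cover, a larger density makes
the total failure probability at most \<open>1 / (1 + ln n)\<close>.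

The spread lemma concerns independent pairs, so that an edge could appear with several colours, whereas
each edge of the random hypergraph has a single colour. For \<open>k = 2\<close> the edges with several colours
cannot be neglected. They are harmless nevertheless, because a matching uses each edge at most once:
replacing, edge by edge, the independent colours by a single random colour of the same total probability
never decreases the probability of containing a rainbow perfect matching
(\<open>random_colours_dominate\<close>). Finally, a binomial edge set with mean size at most \<open>m / 2\<close> has size
at most \<open>m\<close> with probability at least \<open>1 / 2\<close>, and additional edges only help, so passing to exactly \<open>m\<close> edges
at most doubles the failure probability (\<open>level_avg_le_binom_expect\<close>).\<close>

section \<open>Binomial random subsets\<close>

text \<open>The expectation of \<open>g\<close> on a random subset of \<open>X\<close> that contains each element independently with
probability \<open>p\<close>. An explicit polynomial in \<open>p\<close> is used instead of a probability mass function
because all the identities needed are then linear recursions over the elements of \<open>X\<close>.\<close>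
definition binom_expect :: "real \<Rightarrow> 'a set \<Rightarrow> ('a set \<Rightarrow> real) \<Rightarrow> real" where
  "binom_expect p X g = (\<Sum>W\<in>Pow X. p ^ card W * (1 - p) ^ card (X - W) * g W)"

lemma binom_expect_empty [simp]: "binom_expect p {} g = g {}"
  by (simp add: binom_expect_def)

lemma binom_expect_insert:
  assumes "finite X" "x \<notin> X"
  shows "binom_expect p (insert x X) g =
           (1 - p) * binom_expect p X g + p * binom_expect p X (\<lambda>W. g (insert x W))"
proof -
  have out: "x \<notin> W" "finite W" if "W \<in> Pow X" for W
    using that assms by (auto intro: finite_subset)
  have inj: "inj_on (insert x) (Pow X)"
    using assms(2) by (intro inj_onI) (metis Diff_insert_absorb PowD subsetD)
  have "binom_expect p (insert x X) g =
      (\<Sum>W\<in>Pow X. p ^ card W * (1 - p) ^ card (insert x X - W) * g W)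
    + (\<Sum>W\<in>insert x ` Pow X. p ^ card W * (1 - p) ^ card (insert x X - W) * g W)"
    unfolding binom_expect_def Pow_insert using assms
    by (intro sum.union_disjoint) auto
  also have "(\<Sum>W\<in>Pow X. p ^ card W * (1 - p) ^ card (insert x X - W) * g W)
           = (1 - p) * binom_expect p X g"
    unfolding binom_expect_def sum_distrib_left
    by (intro sum.cong) (use assms out in \<open>auto simp: insert_Diff_if\<close>)
  also have "(\<Sum>W\<in>insert x ` Pow X. p ^ card W * (1 - p) ^ card (insert x X - W) * g W)
           = p * binom_expect p X (\<lambda>W. g (insert x W))"
    unfolding binom_expect_def sum_distrib_left sum.reindex[OF inj]
    by (intro sum.cong) (use assms out in \<open>auto simp: insert_Diff_if\<close>)
  finally show ?thesis .
qed

lemma binom_expect_cmult: "binom_expect p X (\<lambda>W. c * g W) = c * binom_expect p X g"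
  by (simp add: binom_expect_def sum_distrib_left algebra_simps)

lemma binom_expect_add:
  "binom_expect p X (\<lambda>W. f W + g W) = binom_expect p X f + binom_expect p X g"
  by (simp add: binom_expect_def sum.distrib algebra_simps)

lemma binom_expect_diff:
  "binom_expect p X (\<lambda>W. f W - g W) = binom_expect p X f - binom_expect p X g"
  by (simp add: binom_expect_def sum_subtractf algebra_simps)

lemma binom_expect_sum:
  "binom_expect p X (\<lambda>W. \<Sum>i\<in>I. f i W) = (\<Sum>i\<in>I. binom_expect p X (f i))"
  unfolding binom_expect_def sum_distrib_left by (rule sum.swap)

lemma binom_expect_const [simp]: "finite X \<Longrightarrow> binom_expect p X (\<lambda>_. c) = c"
  by (induction X rule: finite_induct) (auto simp: binom_expect_insert algebra_simps)

lemma binom_expect_cong: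
  "(\<And>W. W \<subseteq> X \<Longrightarrow> f W = g W) \<Longrightarrow> binom_expect p X f = binom_expect p X g"
  unfolding binom_expect_def by (intro sum.cong) auto

lemma binom_expect_mono:
  assumes "0 \<le> p" "p \<le> 1" "\<And>W. W \<subseteq> X \<Longrightarrow> f W \<le> g W"
  shows "binom_expect p X f \<le> binom_expect p X g"
  unfolding binom_expect_def using assms by (intro sum_mono mult_left_mono) auto

text \<open>Rounds of random exposure combine: an element is missing from the union of two independent binomial
sets exactly if it is missing from both of them.\<close>
lemma binom_expect_merge:
  assumes "finite X"
  shows "binom_expect p X (\<lambda>W. binom_expect r X (\<lambda>V. g (W \<union> V)))
       = binom_expect (1 - (1 - p) * (1 - r)) X g"
  using assms
proof (induction X arbitrary: g rule: finite_induct)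
  case (insert x X)
  let ?q = "1 - (1 - p) * (1 - r)"
  have inner: "binom_expect p X (\<lambda>W. binom_expect r (insert x X) (\<lambda>V. h (W \<union> V)))
      = (1 - r) * binom_expect ?q X h + r * binom_expect ?q X (\<lambda>W. h (insert x W))" for h
    using insert.hyps
    by (simp add: binom_expect_insert binom_expect_add binom_expect_cmult
        insert.IH[of h] insert.IH[of "\<lambda>W. h (insert x W)"])
  have "binom_expect p (insert x X) (\<lambda>W. binom_expect r (insert x X) (\<lambda>V. g (W \<union> V)))
      = (1 - p) * ((1 - r) * binom_expect ?q X g + r * binom_expect ?q X (\<lambda>W. g (insert x W)))
      + p * ((1 - r) * binom_expect ?q X (\<lambda>W. g (insert x W))
            + r * binom_expect ?q X (\<lambda>W. g (insert x W)))"
    using inner[of g] inner[of "\<lambda>W. g (insert x W)"] insert.hyps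
    by (simp add: binom_expect_insert[of X x p])
  also have "\<dots> = binom_expect ?q (insert x X) g"
    using insert.hyps by (simp add: binom_expect_insert algebra_simps)
  finally show ?case .
qed simp

lemma binom_expect_Un_disjoint:
  assumes "finite X" "finite Y" "X \<inter> Y = {}"
  shows "binom_expect p (X \<union> Y) g = binom_expect p X (\<lambda>W. binom_expect p Y (\<lambda>V. g (W \<union> V)))"
  using assms by (induction X arbitrary: g rule: finite_induct) (auto simp: binom_expect_insert)

text \<open>The event of containing no member of a family only gets less likely as the density grows; this
replaces the exact density produced by merging rounds by any upper bound of it.\<close>
lemma binom_expect_antimono_prob:
  assumes "finite X" "0 \<le> p" "p \<le> r" "r \<le> 1" "antimono g"
  shows "binom_expect r X g \<le> binom_expect p X g"
  using assms(1,5)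
proof (induction X arbitrary: g rule: finite_induct)
  case (insert x X)
  let ?h = "\<lambda>W. g (insert x W)"
  have h: "antimono ?h"
    by (intro antimonoI antimonoD[OF insert.prems]) auto
  have "binom_expect p X ?h \<le> binom_expect p X g"
    using assms by (intro binom_expect_mono antimonoD[OF insert.prems]) auto
  then have "0 \<le> (r - p) * (binom_expect p X g - binom_expect p X ?h)"
    using assms by simp
  moreover have "(1 - r) * binom_expect r X g \<le> (1 - r) * binom_expect p X g"
    using assms insert by (intro mult_left_mono) auto
  moreover have "r * binom_expect r X ?h \<le> r * binom_expect p X ?h"
    using assms insert.IH[OF h] by (intro mult_left_mono) auto
  ultimately show ?case
    using insert by (simp add: binom_expect_insert algebra_simps)
qed simp

lemma binom_expect_sum_members:
  assumes "finite X"
  shows "binom_expect p X (\<lambda>W. \<Sum>x\<in>W. a x) = p * (\<Sum>x\<in>X. a x)"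
  using assms
proof (induction X rule: finite_induct)
  case (insert x X)
  have "binom_expect p X (\<lambda>W. \<Sum>y\<in>insert x W. a y) = binom_expect p X (\<lambda>W. a x + (\<Sum>y\<in>W. a y))"
    using insert by (intro binom_expect_cong sum.insert) (auto intro: finite_subset)
  then show ?case
    using insert by (simp add: binom_expect_insert binom_expect_add algebra_simps)
qed simp

section \<open>Covering a member of a spread family\<close>

text \<open>\<open>T\<close> is what remains to be covered, after \<open>W\<close> has been revealed, of a best member among those that
the pair of \<open>A i\<close> and \<open>W\<close> can offer. The member \<open>A j\<close> may differ from \<open>A i\<close>, but it lies inside
\<open>A i \<union> W\<close>, so that \<open>T \<subseteq> A i\<close> and fragments inherit the spread of the original family.\<close>
definition is_fragment :: "'i set \<Rightarrow> ('i \<Rightarrow> 'a set) \<Rightarrow> 'a set \<Rightarrow> 'i \<Rightarrow> 'a set \<Rightarrow> bool" where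
  "is_fragment J A W i T \<longleftrightarrow>
     T \<in> (\<lambda>j. A j - W) ` {j \<in> J. A j \<subseteq> A i \<union> W} \<and>
     (\<forall>j\<in>J. A j \<subseteq> A i \<union> W \<longrightarrow> card T \<le> card (A j - W))"

lemma fragment_exists:
  assumes "i \<in> J"
  shows "\<exists>T. is_fragment J A W i T"
proof -
  let ?P = "\<lambda>j. j \<in> J \<and> A j \<subseteq> A i \<union> W"
  have "?P i" using assms by auto
  from ex_has_least_nat[of ?P i "\<lambda>j. card (A j - W)", OF this]
  obtain j where "?P j" "\<And>j'. ?P j' \<Longrightarrow> card (A j - W) \<le> card (A j' - W)" by blast
  then show ?thesis
    unfolding is_fragment_def by (intro exI[of _ "A j - W"]) auto
qed

text \<open>Few pairs of a set \<open>W\<close> and an index \<open>i\<close> have a large fragment, because such pairs can be encoded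
cheaply. Put \<open>T = \<tau> W i\<close> and record \<open>Z = W \<union> T\<close>. The set \<open>Z\<close> contains some member of the family;
let \<open>B Z\<close> be a fixed one. Since \<open>B Z - W \<subseteq> T\<close>, the minimality of \<open>T\<close> forces \<open>B Z - W = T\<close>, so \<open>T\<close> is
one of the at most \<open>4 ^ s\<close> subsets of \<open>B Z\<close>. The pair of \<open>Z\<close> and \<open>T\<close> determines \<open>W\<close>, and the spread
bounds the number of \<open>i\<close> with \<open>T \<subseteq> A i\<close> by \<open>M * \<sigma> ^ card T\<close>. Passing from the weight of \<open>W\<close> to that
of \<open>Z\<close> costs at most \<open>(1 / p) ^ card T\<close>.\<close>
lemma fragment_round:
  fixes A :: "'i \<Rightarrow> 'a set" and \<sigma> p M :: real
  assumes fin: "finite X" "finite J" and sub: "\<And>i. i \<in> J \<Longrightarrow> A i \<subseteq> X"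
    and spread: "\<And>T. T \<subseteq> X \<Longrightarrow> card {i \<in> J. T \<subseteq> A i} \<le> M * \<sigma> ^ card T"
    and size: "\<And>i. i \<in> J \<Longrightarrow> card (A i) \<le> 2 * s"
    and p: "0 < \<sigma>" "\<sigma> \<le> p" "p \<le> 1" and M: "0 \<le> M"
    and frag: "\<And>W i. W \<subseteq> X \<Longrightarrow> i \<in> J \<Longrightarrow> is_fragment J A W i (\<tau> W i)"
  shows "binom_expect p X (\<lambda>W. card {i \<in> J. s \<le> card (\<tau> W i)}) \<le> M * (4 * \<sigma> / p) ^ s"
proof -
  have p0: "p > 0" using p by linarith
  define wt where "wt W = p ^ card W * (1 - p) ^ card (X - W)" for W
  have wt0: "wt W \<ge> 0" for W
    using p p0 by (simp add: wt_def)
  define B where "B Z = (if \<exists>i\<in>J. A i \<subseteq> Z then A (SOME i. i \<in> J \<and> A i \<subseteq> Z) else {})" for Z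
  have B: "\<exists>i\<in>J. B Z = A i \<and> A i \<subseteq> Z" if "\<exists>i\<in>J. A i \<subseteq> Z" for Z
    using someI_ex[of "\<lambda>i. i \<in> J \<and> A i \<subseteq> Z"] that unfolding B_def by auto
  have Bsub: "B Z \<subseteq> X" for Z
  proof (cases "\<exists>i\<in>J. A i \<subseteq> Z")
    case True with B[of Z] sub show ?thesis by blast
  qed (simp add: B_def)
  have Bcard: "card (B Z) \<le> 2 * s" for Z
  proof (cases "\<exists>i\<in>J. A i \<subseteq> Z")
    case True with B[of Z] size show ?thesis by metis
  qed (simp add: B_def)
  have Bfin: "finite (B Z)" for Z using Bsub fin finite_subset by blast
  have \<tau>: "\<tau> W i \<subseteq> A i" "\<tau> W i \<inter> W = {}" "\<tau> W i \<subseteq> X" "\<tau> W i \<subseteq> B (W \<union> \<tau> W i)"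
    if W: "W \<subseteq> X" and i: "i \<in> J" for W i
  proof -
    note f = frag[OF W i, unfolded is_fragment_def]
    from f obtain j where j: "j \<in> J" "A j \<subseteq> A i \<union> W" "\<tau> W i = A j - W" by auto
    show 1: "\<tau> W i \<subseteq> A i" "\<tau> W i \<inter> W = {}" using j by auto
    show 2: "\<tau> W i \<subseteq> X" using 1 sub[OF i] by blast
    have "\<exists>i'\<in>J. A i' \<subseteq> W \<union> \<tau> W i" using j by auto
    from B[OF this] obtain j' where j': "j' \<in> J" "B (W \<union> \<tau> W i) = A j'" "A j' \<subseteq> W \<union> \<tau> W i"
      by blast
    \<comment> \<open>\<open>A j'\<close> competes in the minimum that defines \<open>\<tau> W i\<close>.\<close>
    have "card (\<tau> W i) \<le> card (A j' - W)"
      using f j' 1 by blast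
    moreover have "A j' - W \<subseteq> \<tau> W i" "finite (\<tau> W i)"
      using j' 2 fin by (auto intro: finite_subset)
    ultimately have "A j' - W = \<tau> W i"
      by (meson card_seteq)
    then show "\<tau> W i \<subseteq> B (W \<union> \<tau> W i)" using j' by auto
  qed
  have wt_le: "wt W \<le> wt (W \<union> T) * (1 / p) ^ card T" if "W \<subseteq> X" "T \<subseteq> X" "T \<inter> W = {}" for W T
  proof -
    have f: "finite W" "finite T" "finite (X - W)" using that fin by (auto intro: finite_subset)
    have "card (X - (W \<union> T)) \<le> card (X - W)"
      using f by (intro card_mono) auto
    then have "(1 - p) ^ card (X - W) \<le> (1 - p) ^ card (X - (W \<union> T))"
      using p p0 by (intro power_decreasing) auto
    moreover have "card (W \<union> T) = card W + card T"
      using that f by (intro card_Un_disjoint) auto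
    ultimately show ?thesis
      using p0 by (simp add: wt_def power_add field_simps)
  qed
  define D where "D = (SIGMA W:Pow X. {i \<in> J. s \<le> card (\<tau> W i)})"
  define \<phi> where "\<phi> = (\<lambda>(W, i). (W \<union> \<tau> W i, \<tau> W i, i))"
  define R where "R = (SIGMA Z:Pow X. SIGMA T:{T \<in> Pow (B Z). s \<le> card T}. {i \<in> J. T \<subseteq> A i})"
  have inj: "inj_on \<phi> D"
  proof (rule inj_onI)
    fix u v assume uv: "u \<in> D" "v \<in> D" "\<phi> u = \<phi> v"
    obtain W i W' i' where [simp]: "u = (W, i)" "v = (W', i')" by (cases u, cases v)
    from uv have *: "W \<subseteq> X" "i \<in> J" "W' \<subseteq> X" "i' \<in> J" by (auto simp: D_def)
    from uv have "i = i'" "W \<union> \<tau> W i = W' \<union> \<tau> W' i'" "\<tau> W i = \<tau> W' i'" by (auto simp: \<phi>_def)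
    with \<tau>(2)[OF *(1,2)] \<tau>(2)[OF *(3,4)] show "u = v" by auto
  qed
  have img: "\<phi> ` D \<subseteq> R"
    using \<tau> by (fastforce simp: \<phi>_def D_def R_def)
  have finR: "finite R"
    unfolding R_def using fin Bfin by (intro finite_SigmaI) auto
  have "binom_expect p X (\<lambda>W. card {i \<in> J. s \<le> card (\<tau> W i)})
      = (\<Sum>W\<in>Pow X. \<Sum>i\<in>{i \<in> J. s \<le> card (\<tau> W i)}. wt W)"
    unfolding binom_expect_def wt_def by (simp add: mult.commute)
  also have "\<dots> = (\<Sum>(W, i)\<in>D. wt W)"
    unfolding D_def by (rule sum.Sigma) (use fin in auto)
  also have "\<dots> \<le> (\<Sum>u\<in>D. (\<lambda>(Z, T, i). wt Z * (1 / p) ^ card T) (\<phi> u))"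
    using wt_le \<tau> by (intro sum_mono) (auto simp: D_def \<phi>_def)
  also have "\<dots> = (\<Sum>(Z, T, i)\<in>\<phi> ` D. wt Z * (1 / p) ^ card T)"
    by (simp add: sum.reindex[OF inj])
  also have "\<dots> \<le> (\<Sum>(Z, T, i)\<in>R. wt Z * (1 / p) ^ card T)"
    using finR img wt0 p0 by (intro sum_mono2) auto
  also have "\<dots> = (\<Sum>Z\<in>Pow X. \<Sum>T\<in>{T \<in> Pow (B Z). s \<le> card T}. \<Sum>i\<in>{i \<in> J. T \<subseteq> A i}.
                    wt Z * (1 / p) ^ card T)"
    unfolding R_def using fin Bfin by (simp add: sum.Sigma[symmetric])
  also have "\<dots> = (\<Sum>Z\<in>Pow X. wt Z * (\<Sum>T\<in>{T \<in> Pow (B Z). s \<le> card T}.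
                    (1 / p) ^ card T * card {i \<in> J. T \<subseteq> A i}))"
    by (simp add: sum_distrib_left mult_ac)
  also have "\<dots> \<le> (\<Sum>Z\<in>Pow X. wt Z * (M * (4 * \<sigma> / p) ^ s))"
  proof (intro sum_mono mult_left_mono wt0)
    fix Z
    have "(1 / p) ^ card T * card {i \<in> J. T \<subseteq> A i} \<le> M * (\<sigma> / p) ^ s"
      if "T \<subseteq> B Z" "s \<le> card T" for T
    proof -
      have "(1 / p) ^ card T * card {i \<in> J. T \<subseteq> A i} \<le> (1 / p) ^ card T * (M * \<sigma> ^ card T)"
        using that Bsub p0 by (intro mult_left_mono spread) auto
      also have "\<dots> = M * (\<sigma> / p) ^ card T"
        by (simp add: power_divide)
      also have "\<dots> \<le> M * (\<sigma> / p) ^ s"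
        using that M p p0 by (intro mult_left_mono power_decreasing) auto
      finally show ?thesis .
    qed
    then have "(\<Sum>T\<in>{T \<in> Pow (B Z). s \<le> card T}. (1 / p) ^ card T * card {i \<in> J. T \<subseteq> A i})
      \<le> card {T \<in> Pow (B Z). s \<le> card T} * (M * (\<sigma> / p) ^ s)"
      by (intro sum_bounded_above) auto
    also have "card {T \<in> Pow (B Z). s \<le> card T} \<le> card (Pow (B Z))"
      using Bfin by (intro card_mono) auto
    also have "\<dots> \<le> 2 ^ (2 * s)"
      using Bfin Bcard by (simp add: card_Pow)
    also have "real (2 ^ (2 * s)) * (M * (\<sigma> / p) ^ s) = M * (4 * \<sigma> / p) ^ s"
      by (simp add: power_mult power_divide power_mult_distrib)
    finally show "(\<Sum>T\<in>{T \<in> Pow (B Z). s \<le> card T}. (1 / p) ^ card T * card {i \<in> J. T \<subseteq> A i})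
      \<le> M * (4 * \<sigma> / p) ^ s"
      using M p p0 by (simp add: mult_right_mono)
  qed
  also have "\<dots> = binom_expect p X (\<lambda>_. M * (4 * \<sigma> / p) ^ s)"
    by (simp add: binom_expect_def wt_def)
  also have "\<dots> = M * (4 * \<sigma> / p) ^ s"
    using fin by simp
  finally show ?thesis .
qed

text \<open>The spread lemma. The rounds use the densities \<open>p (l - 1), ..., p 0\<close>, and the round with density \<open>p j\<close>
replaces each remaining set of size below \<open>2 ^ (j + 1)\<close> by its fragment, dropping the indices whose
fragment still has at least \<open>2 ^ j\<close> elements. If an index survives all rounds, its last fragment is
empty, so a member has been covered. On failure every index is dropped in some round; hence
\<open>card J\<close> times the failure probability is at most the expected number of dropped indices. The
bound \<open>M\<close> stays fixed while \<open>J\<close> shrinks in the induction, which is why \<open>card J\<close> appears separately.\<close>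
theorem spread_family_covered:
  fixes A :: "'i \<Rightarrow> 'a set" and \<sigma> M :: real and p :: "nat \<Rightarrow> real"
  assumes fin: "finite X" "finite J" and sub: "\<And>i. i \<in> J \<Longrightarrow> A i \<subseteq> X"
    and spread: "\<And>T. T \<subseteq> X \<Longrightarrow> card {i \<in> J. T \<subseteq> A i} \<le> M * \<sigma> ^ card T"
    and size: "\<And>i. i \<in> J \<Longrightarrow> card (A i) < 2 ^ l"
    and p: "0 < \<sigma>" "\<And>j. j < l \<Longrightarrow> \<sigma> \<le> p j" "\<And>j. j < l \<Longrightarrow> p j \<le> 1" and M: "0 \<le> M"
  shows "card J * binom_expect (1 - (\<Prod>j<l. 1 - p j)) X (\<lambda>Y. of_bool (\<not> (\<exists>i\<in>J. A i \<subseteq> Y)))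
           \<le> M * (\<Sum>j<l. (4 * \<sigma> / p j) ^ (2 ^ j))"
  using fin(2) sub spread size p(2,3)
proof (induction l arbitrary: J A)
  case 0
  have empty: "A i = {}" if "i \<in> J" for i
    using 0(2)[OF that] 0(4)[OF that] fin(1) by (metis card_0_eq finite_subset less_one power_0)
  have "card J * binom_expect 0 X (\<lambda>Y. of_bool (\<not> (\<exists>i\<in>J. A i \<subseteq> Y))) = 0"
  proof (cases "J = {}")
    case False
    then have "(\<lambda>Y. of_bool (\<not> (\<exists>i\<in>J. A i \<subseteq> Y))) = (\<lambda>_. 0::real)"
      using empty by fastforce
    then show ?thesis using fin by (simp only: binom_expect_const)
  qed simp
  then show ?case
    by (simp only: lessThan_0 prod.empty sum.empty diff_self mult_zero_right order_refl)
next
  case (Suc l)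
  note finJ = Suc.prems(1) and sub = Suc.prems(2) and spread = Suc.prems(3)
  note size = Suc.prems(4) and pl = Suc.prems(5)[of l] and pu = Suc.prems(6)[of l]
  define r where "r = 1 - (\<Prod>j<l. 1 - p j)"
  have pr: "0 \<le> 1 - p j \<and> 1 - p j \<le> 1" if "j < l" for j
    using Suc.prems(5)[of j] Suc.prems(6)[of j] p(1) that by simp
  have r: "0 \<le> r" "r \<le> 1"
    unfolding r_def using pr by (auto intro!: prod_nonneg prod_le_1)
  have p0: "0 \<le> p l" "p l \<le> 1" using pl pu p(1) by auto
  define \<tau> where "\<tau> W i = (SOME T. is_fragment J A W i T)" for W i
  have frag: "is_fragment J A W i (\<tau> W i)" if "i \<in> J" for W i
    unfolding \<tau>_def using fragment_exists[OF that] by (rule someI_ex)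
  have \<tau>A: "\<tau> W i \<subseteq> A i" if "i \<in> J" for W i
    using frag[OF that, of W] by (auto simp: is_fragment_def)
  define J' where "J' W = {i \<in> J. card (\<tau> W i) < 2 ^ l}" for W
  define fails where "fails Y = (of_bool (\<not> (\<exists>i\<in>J. A i \<subseteq> Y)) :: real)" for Y
  define F where "F W = binom_expect r X (\<lambda>V. fails (W \<union> V))" for W
  have fails: "0 \<le> fails Y" "fails Y \<le> 1" for Y
    by (auto simp: fails_def)
  have F1: "F W \<le> 1" for W
    using binom_expect_mono[of r X "\<lambda>V. fails (W \<union> V)" "\<lambda>_. 1"] r fails fin(1) by (simp add: F_def)
  have step: "card (J' W) * F W \<le> M * (\<Sum>j<l. (4 * \<sigma> / p j) ^ (2 ^ j))" if W: "W \<subseteq> X" for W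
  proof -
    have "card {i \<in> J' W. T \<subseteq> \<tau> W i} \<le> M * \<sigma> ^ card T" if "T \<subseteq> X" for T
    proof -
      have "card {i \<in> J' W. T \<subseteq> \<tau> W i} \<le> card {i \<in> J. T \<subseteq> A i}"
        using \<tau>A finJ by (intro card_mono) (auto simp: J'_def)
      with spread[OF that] show ?thesis by linarith
    qed
    then have IH: "card (J' W) * binom_expect r X (\<lambda>Y. of_bool (\<not> (\<exists>i\<in>J' W. \<tau> W i \<subseteq> Y)))
        \<le> M * (\<Sum>j<l. (4 * \<sigma> / p j) ^ (2 ^ j))"
      unfolding r_def using finJ sub \<tau>A Suc.prems(5,6)
      by (intro Suc.IH) (auto simp: J'_def, blast)
    \<comment> \<open>A covered fragment \<open>A j - W\<close> completes the member \<open>A j\<close>.\<close>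
    have "fails (W \<union> V) \<le> of_bool (\<not> (\<exists>i\<in>J' W. \<tau> W i \<subseteq> V))" for V
    proof (cases "\<exists>i\<in>J' W. \<tau> W i \<subseteq> V")
      case True
      then obtain i where i: "i \<in> J" "\<tau> W i \<subseteq> V" by (auto simp: J'_def)
      from frag[OF i(1), of W] obtain j where "j \<in> J" "\<tau> W i = A j - W"
        by (auto simp: is_fragment_def)
      with i have "\<exists>j\<in>J. A j \<subseteq> W \<union> V" by blast
      then show ?thesis by (simp add: fails_def)
    qed (use fails in auto)
    then have "F W \<le> binom_expect r X (\<lambda>Y. of_bool (\<not> (\<exists>i\<in>J' W. \<tau> W i \<subseteq> Y)))"
      unfolding F_def using r by (intro binom_expect_mono) auto
    with IH show ?thesis
      by (meson mult_left_mono of_nat_0_le_iff order_trans)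
  qed
  have split: "card J * F W \<le> M * (\<Sum>j<l. (4 * \<sigma> / p j) ^ (2 ^ j)) + card {i \<in> J. 2 ^ l \<le> card (\<tau> W i)}"
    if W: "W \<subseteq> X" for W
  proof -
    have "J = J' W \<union> {i \<in> J. 2 ^ l \<le> card (\<tau> W i)}" "J' W \<inter> {i \<in> J. 2 ^ l \<le> card (\<tau> W i)} = {}"
      by (auto simp: J'_def)
    then have "card J = card (J' W) + card {i \<in> J. 2 ^ l \<le> card (\<tau> W i)}"
      using finJ by (metis card_Un_disjoint finite_Un)
    then have "card J * F W = card (J' W) * F W + card {i \<in> J. 2 ^ l \<le> card (\<tau> W i)} * F W"
      by (simp add: algebra_simps)
    also have "\<dots> \<le> M * (\<Sum>j<l. (4 * \<sigma> / p j) ^ (2 ^ j)) + real (card {i \<in> J. 2 ^ l \<le> card (\<tau> W i)}) * 1"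
      by (intro add_mono step[OF W] mult_left_mono[OF F1] of_nat_0_le_iff)
    finally show ?thesis by simp
  qed
  have q: "1 - (\<Prod>j<Suc l. 1 - p j) = 1 - (1 - p l) * (1 - r)"
    by (simp add: r_def)
  have "card J * binom_expect (1 - (\<Prod>j<Suc l. 1 - p j)) X fails
      = binom_expect (p l) X (\<lambda>W. card J * F W)"
    unfolding q F_def binom_expect_merge[OF fin(1), symmetric] binom_expect_cmult ..
  also have "\<dots> \<le> binom_expect (p l) X (\<lambda>W. M * (\<Sum>j<l. (4 * \<sigma> / p j) ^ (2 ^ j))
                    + card {i \<in> J. 2 ^ l \<le> card (\<tau> W i)})"
    using p0 split by (intro binom_expect_mono) auto
  also have "\<dots> = M * (\<Sum>j<l. (4 * \<sigma> / p j) ^ (2 ^ j))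
                    + binom_expect (p l) X (\<lambda>W. card {i \<in> J. 2 ^ l \<le> card (\<tau> W i)})"
    using fin(1) by (simp add: binom_expect_add)
  also have "binom_expect (p l) X (\<lambda>W. card {i \<in> J. 2 ^ l \<le> card (\<tau> W i)}) \<le> M * (4 * \<sigma> / p l) ^ 2 ^ l"
  proof (rule fragment_round[where A = A and J = J])
    show "card (A i) \<le> 2 * 2 ^ l" if "i \<in> J" for i
      using size[OF that] by simp
    show "A i \<subseteq> X" if "i \<in> J" for i using sub[OF that] .
    show "card {i \<in> J. T \<subseteq> A i} \<le> M * \<sigma> ^ card T" if "T \<subseteq> X" for T using spread[OF that] .
    show "is_fragment J A W i (\<tau> W i)" if "i \<in> J" for W i using frag[OF that] .
  qed (use fin(1) finJ pl pu p(1) M in simp_all)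
  finally have bound: "card J * binom_expect (1 - (\<Prod>j<Suc l. 1 - p j)) X fails
      \<le> M * (\<Sum>j<Suc l. (4 * \<sigma> / p j) ^ (2 ^ j))"
    by (simp add: distrib_left)
  have "(\<lambda>Y. of_bool (\<not> (\<exists>i\<in>J. A i \<subseteq> Y))) = fails"
    by (simp add: fails_def fun_eq_iff)
  with bound show ?case by (simp only:)
qed

section \<open>One random colour per edge against independent coloured edges\<close>

text \<open>A coloured edge set is turned into the set of its (edge, colour) pairs, so that both random models
live on subsets of the same set of pairs.\<close>
definition colour_expect :: "nat \<Rightarrow> 'e set \<Rightarrow> (('e \<times> nat) set \<Rightarrow> real) \<Rightarrow> real" where
  "colour_expect n E g = measure_pmf.expectation (Pi_pmf E 0 (\<lambda>_. pmf_of_set {1..n}))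
                           (\<lambda>c. g ((\<lambda>e. (e, c e)) ` E))"

lemma finite_set_Pi_pmf_colours:
  "finite E \<Longrightarrow> n > 0 \<Longrightarrow> finite (set_pmf (Pi_pmf E (0::nat) (\<lambda>_. pmf_of_set {1..n})))"
  by (rule finite_subset[OF set_Pi_pmf_subset']) (auto intro!: finite_PiE_dflt)

lemma colour_expect_empty [simp]: "colour_expect n {} g = g {}"
  by (simp add: colour_expect_def)

lemma colour_expect_insert:
  assumes "finite E" "e \<notin> E" "n > 0"
  shows "colour_expect n (insert e E) g
           = (\<Sum>c\<in>{1..n}. colour_expect n E (\<lambda>Y. g (insert (e, c) Y))) / n"
proof -
  let ?P = "Pi_pmf E 0 (\<lambda>_. pmf_of_set {1..n})"
  have img: "(\<lambda>e'. (e', (f(e := c)) e')) ` insert e E = insert (e, c) ((\<lambda>e'. (e', f e')) ` E)" for f c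
    using assms(2) by (auto simp: image_iff)
  have "colour_expect n (insert e E) g
      = (\<Sum>c\<in>{1..n}. measure_pmf.expectation (?P \<bind> (\<lambda>f. return_pmf (f(e := c))))
           (\<lambda>f. g ((\<lambda>e'. (e', f e')) ` insert e E)) /\<^sub>R card {1..n})"
    unfolding colour_expect_def Pi_pmf_insert'[OF assms(1,2)]
    using assms finite_set_Pi_pmf_colours[OF assms(1,3)]
    by (intro pmf_expectation_bind_pmf_of_set) auto
  also have "\<dots> = (\<Sum>c\<in>{1..n}. colour_expect n E (\<lambda>Y. g (insert (e, c) Y)) / n)"
    unfolding colour_expect_def map_pmf_def[symmetric]
    by (simp add: img divide_inverse mult.commute del: fun_upd_apply image_insert)
  finally show ?thesis by (simp add: sum_divide_distrib)
qed

lemma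
  assumes "finite E" "n > 0"
  shows colour_expect_mono:
          "(\<And>Y. f Y \<le> g Y) \<Longrightarrow> colour_expect n E f \<le> colour_expect n E g"
    and colour_expect_diff:
          "colour_expect n E (\<lambda>Y. f Y - g Y) = colour_expect n E f - colour_expect n E g"
    and colour_expect_sum:
          "colour_expect n E (\<lambda>Y. \<Sum>i\<in>I. h i Y) = (\<Sum>i\<in>I. colour_expect n E (h i))"
proof -
  note int = integrable_measure_pmf_finite[OF finite_set_Pi_pmf_colours[OF assms]]
  show "(\<And>Y. f Y \<le> g Y) \<Longrightarrow> colour_expect n E f \<le> colour_expect n E g"
    unfolding colour_expect_def by (intro integral_mono int)
  show "colour_expect n E (\<lambda>Y. f Y - g Y) = colour_expect n E f - colour_expect n E g"
    unfolding colour_expect_def by (intro Bochner_Integration.integral_diff int)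
  show "colour_expect n E (\<lambda>Y. \<Sum>i\<in>I. h i Y) = (\<Sum>i\<in>I. colour_expect n E (h i))"
    unfolding colour_expect_def by (intro Bochner_Integration.integral_sum int)
qed

lemma colour_expect_insert_mono:
  assumes "finite E" "n > 0" "antimono g"
  shows "colour_expect n (insert e E) g \<le> colour_expect n E g"
proof (cases "e \<in> E")
  case True
  then show ?thesis by (simp add: insert_absorb)
next
  case False
  have "(\<Sum>c\<in>{1..n}. colour_expect n E (\<lambda>Y. g (insert (e, c) Y))) \<le> (\<Sum>c\<in>{1..n}. colour_expect n E g)"
    using assms by (intro sum_mono colour_expect_mono antimonoD[OF assms(3)]) auto
  then show ?thesis
    using assms False by (simp add: colour_expect_insert field_simps)
qed

text \<open>For decreasing indicators \<open>g\<close> this is a union bound: if adding the pairs \<open>W\<close>, all on the same edge \<open>e\<close>,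
destroys \<open>g\<close>, then adding a single one of them already does. The inequality is linear in \<open>g\<close> and
invariant under adding a fixed set of pairs to the argument, as needed for induction over the edges.\<close>
definition subadditive_per_edge :: "(('e \<times> nat) set \<Rightarrow> real) \<Rightarrow> bool" where
  "subadditive_per_edge g \<longleftrightarrow>
     (\<forall>Y e W. finite W \<longrightarrow> fst ` W \<subseteq> {e} \<longrightarrow> g Y - (\<Sum>w\<in>W. g Y - g (insert w Y)) \<le> g (W \<union> Y))"

text \<open>McDiarmid's swapping argument, where \<open>g\<close> is to be read as the indicator of missing a given family. If
edges appear with probability \<open>p\<close> and then receive one uniform colour, the family is at least
as likely to be hit as if all (edge, colour) pairs appeared
independently with probability \<open>p / n\<close>. The two models are exchanged one edge at a time: with all
other edges fixed, let \<open>a\<close> of the colours of this edge complete a member of the family. In the first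
model one of them appears with probability exactly \<open>a * p / n\<close>, and in the second with probability at
most that, by the union bound.\<close>
lemma random_colours_dominate:
  assumes "finite K" "n > 0" "0 \<le> p" "p \<le> 1" "subadditive_per_edge g"
  shows "binom_expect p K (\<lambda>E. colour_expect n E g) \<le> binom_expect (p / n) (K \<times> {1..n}) g"
  using assms(1,5)
proof (induction K arbitrary: g rule: finite_induct)
  case (insert e K)
  define q where "q = p / n"
  have "p \<le> real n" using assms(2,4) by (cases n) auto
  then have q: "0 \<le> q" "q \<le> 1" using assms by (auto simp: q_def)
  define D where "D g = binom_expect p K (\<lambda>E. colour_expect n E g)" for g
  have finE: "finite E" if "E \<subseteq> K" for E using that insert.hyps(1) finite_subset by blast
  have D_mono: "D f \<le> D h" if "\<And>Y. f Y \<le> h Y" for f h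
    unfolding D_def using assms that finE by (intro binom_expect_mono colour_expect_mono) auto
  have D_diff: "D (\<lambda>Y. f Y - h Y) = D f - D h" for f h
    unfolding D_def binom_expect_diff[symmetric]
    by (intro binom_expect_cong colour_expect_diff finE assms)
  have D_sum: "D (\<lambda>Y. \<Sum>i\<in>I. h i Y) = (\<Sum>i\<in>I. D (h i))" for I h
    unfolding D_def binom_expect_sum[symmetric]
    by (intro binom_expect_cong colour_expect_sum finE assms)
  let ?X = "{e} \<times> {1..n}"
  have sub: "g Y - (\<Sum>w\<in>W. g Y - g (insert w Y)) \<le> g (W \<union> Y)" if "W \<subseteq> ?X" for W Y
  proof -
    have "finite W" "fst ` W \<subseteq> {e}"
      using that by (auto intro: finite_subset)
    then show ?thesis
      using insert.prems unfolding subadditive_per_edge_def by blast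
  qed
  have "binom_expect p (insert e K) (\<lambda>E. colour_expect n E g)
      = (1 - p) * D g + p * binom_expect p K (\<lambda>E. colour_expect n (insert e E) g)"
    using insert.hyps by (simp add: binom_expect_insert D_def)
  also have "binom_expect p K (\<lambda>E. colour_expect n (insert e E) g)
      = binom_expect p K (\<lambda>E. (1 / n) * (\<Sum>c\<in>{1..n}. colour_expect n E (\<lambda>Y. g (insert (e, c) Y))))"
    using insert.hyps assms finE by (intro binom_expect_cong, subst colour_expect_insert) auto
  also have "\<dots> = (1 / n) * (\<Sum>c\<in>{1..n}. D (\<lambda>Y. g (insert (e, c) Y)))"
    unfolding binom_expect_cmult binom_expect_sum D_def ..
  also have "(1 - p) * D g + p * \<dots> = D g - q * (\<Sum>c\<in>{1..n}. D g - D (\<lambda>Y. g (insert (e, c) Y)))"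
    using assms(2) by (simp add: q_def sum_subtractf field_simps)
  also have "(\<Sum>c\<in>{1..n}. D g - D (\<lambda>Y. g (insert (e, c) Y))) = (\<Sum>w\<in>?X. D g - D (\<lambda>Y. g (insert w Y)))"
    by (simp add: sum.cartesian_product' del: sum_subtractf)
  also have "D g - q * \<dots>
      = binom_expect q ?X (\<lambda>W. D g - (\<Sum>w\<in>W. D g - D (\<lambda>Y. g (insert w Y))))"
    by (simp add: binom_expect_diff binom_expect_sum_members)
  also have "\<dots> \<le> binom_expect q ?X (\<lambda>W. D (\<lambda>Y. g (W \<union> Y)))"
  proof (intro binom_expect_mono q)
    fix W assume "W \<subseteq> ?X"
    have "D g - (\<Sum>w\<in>W. D g - D (\<lambda>Y. g (insert w Y))) = D (\<lambda>Y. g Y - (\<Sum>w\<in>W. g Y - g (insert w Y)))"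
      by (simp add: D_diff D_sum)
    also have "\<dots> \<le> D (\<lambda>Y. g (W \<union> Y))"
      using sub[OF \<open>W \<subseteq> ?X\<close>] by (intro D_mono)
    finally show "D g - (\<Sum>w\<in>W. D g - D (\<lambda>Y. g (insert w Y))) \<le> D (\<lambda>Y. g (W \<union> Y))" .
  qed
  also have "\<dots> \<le> binom_expect q ?X (\<lambda>W. binom_expect q (K \<times> {1..n}) (\<lambda>Y. g (W \<union> Y)))"
  proof (intro binom_expect_mono q)
    fix W assume "W \<subseteq> ?X"
    have "subadditive_per_edge (\<lambda>Y. g (W \<union> Y))"
      unfolding subadditive_per_edge_def
    proof (intro allI impI)
      fix Y e' V assume "finite (V :: ('a \<times> nat) set)" "fst ` V \<subseteq> {e'}"
      with insert.prems
      have "g (W \<union> Y) - (\<Sum>w\<in>V. g (W \<union> Y) - g (insert w (W \<union> Y))) \<le> g (V \<union> (W \<union> Y))"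
        unfolding subadditive_per_edge_def by blast
      then show "g (W \<union> Y) - (\<Sum>w\<in>V. g (W \<union> Y) - g (W \<union> insert w Y)) \<le> g (W \<union> (V \<union> Y))"
        by (simp only: Un_insert_right Un_left_commute)
    qed
    from insert.IH[OF this] show "D (\<lambda>Y. g (W \<union> Y)) \<le> binom_expect q (K \<times> {1..n}) (\<lambda>Y. g (W \<union> Y))"
      by (simp add: D_def q_def)
  qed
  also have "\<dots> = binom_expect q (?X \<union> K \<times> {1..n}) g"
    using insert.hyps by (intro binom_expect_Un_disjoint[symmetric]) auto
  also have "?X \<union> K \<times> {1..n} = insert e K \<times> {1..n}" by auto
  finally show ?case by (simp add: q_def)
qed simp

text \<open>A member of the family uses each edge at most once, so of several pairs on the same edge only one can
help to complete it.\<close>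
lemma subadditive_per_edge_avoid:
  fixes \<S> :: "('e \<times> nat) set set"
  assumes "\<And>S. S \<in> \<S> \<Longrightarrow> inj_on fst S"
  shows "subadditive_per_edge (\<lambda>Y. of_bool (\<not> (\<exists>S\<in>\<S>. S \<subseteq> Y)))"
  unfolding subadditive_per_edge_def
proof (intro allI impI)
  fix Y W :: "('e \<times> nat) set" and e
  assume W: "finite W" "fst ` W \<subseteq> {e}"
  define g where "g = (\<lambda>Y. of_bool (\<not> (\<exists>S\<in>\<S>. S \<subseteq> Y)) :: real)"
  have anti: "g (insert w Y) \<le> g Y" for w by (auto simp: g_def)
  have "g Y - (\<Sum>w\<in>W. g Y - g (insert w Y)) \<le> g (W \<union> Y)"
  proof (cases "g (W \<union> Y) = 0 \<and> g Y = 1")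
    case True
    then obtain S where S: "S \<in> \<S>" "S \<subseteq> W \<union> Y" "\<not> S \<subseteq> Y"
      by (auto simp: g_def split: if_splits)
    then obtain w where w: "w \<in> S" "w \<in> W" by auto
    have "S \<subseteq> insert w Y"
    proof
      fix v assume v: "v \<in> S"
      show "v \<in> insert w Y"
      proof (cases "v \<in> W")
        case True
        with w W have "fst v = fst w" by (metis image_subset_iff singletonD)
        with v w assms[OF S(1)] have "v = w" by (auto dest: inj_onD)
        then show ?thesis by simp
      qed (use v S in auto)
    qed
    with S have "g (insert w Y) = 0" by (auto simp: g_def)
    moreover have "g Y - g (insert w Y) \<le> (\<Sum>w\<in>W. g Y - g (insert w Y))"
      using anti W w by (intro member_le_sum) auto
    ultimately show ?thesis using True by simp
  next
    case False
    have "0 \<le> (\<Sum>w\<in>W. g Y - g (insert w Y))" using anti by (intro sum_nonneg) auto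
    moreover have "g Y \<le> g (W \<union> Y)" using False by (auto simp: g_def)
    ultimately show ?thesis by linarith
  qed
  then show "of_bool (\<not> (\<exists>S\<in>\<S>. S \<subseteq> Y)) - (\<Sum>w\<in>W. of_bool (\<not> (\<exists>S\<in>\<S>. S \<subseteq> Y)) -
       of_bool (\<not> (\<exists>S\<in>\<S>. S \<subseteq> insert w Y))) \<le> (of_bool (\<not> (\<exists>S\<in>\<S>. S \<subseteq> W \<union> Y)) :: real)"
    by (simp add: g_def)
qed

section \<open>From binomial edge sets to edge sets of fixed size\<close>

definition level_avg :: "'a set \<Rightarrow> ('a set \<Rightarrow> real) \<Rightarrow> nat \<Rightarrow> real" where
  "level_avg K h j = (\<Sum>E | E \<subseteq> K \<and> card E = j. h E) / real (card K choose j)"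

text \<open>Double counting of the pairs of a set of size \<open>j + 1\<close> and an element of it. This is the average form of
the coupling that obtains a uniform \<open>(j + 1)\<close>-subset by adding a random element to a uniform
\<open>j\<close>-subset.\<close>
lemma level_avg_Suc_le:
  assumes "finite K" "j < card K"
    and anti: "\<And>E e. E \<subseteq> K \<Longrightarrow> e \<in> K \<Longrightarrow> h (insert e E) \<le> h E"
  shows "level_avg K h (Suc j) \<le> level_avg K h j"
proof -
  let ?L = "\<lambda>j. {E. E \<subseteq> K \<and> card E = j}"
  have fin: "finite (?L j)" for j using assms(1) by simp
  have finE: "finite E" if "E \<subseteq> K" for E using that assms(1) finite_subset by blast
  have "Suc j * (\<Sum>E\<in>?L (Suc j). h E) = (\<Sum>E\<in>?L (Suc j). \<Sum>e\<in>E. h E)"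
    by (simp add: sum_distrib_left)
  also have "\<dots> \<le> (\<Sum>E\<in>?L (Suc j). \<Sum>e\<in>E. h (E - {e}))"
  proof (intro sum_mono)
    fix E e assume "E \<in> ?L (Suc j)" "e \<in> E"
    with anti[of "E - {e}" e] show "h E \<le> h (E - {e})" by (auto simp: insert_absorb)
  qed
  also have "\<dots> = (\<Sum>(E, e)\<in>Sigma (?L (Suc j)) (\<lambda>E. E). h (E - {e}))"
    using fin finE by (intro sum.Sigma) auto
  also have "\<dots> = (\<Sum>(E, e)\<in>Sigma (?L j) (\<lambda>E. K - E). h E)"
    by (rule sum.reindex_bij_witness[of _ "\<lambda>(E, e). (insert e E, e)" "\<lambda>(E, e). (E - {e}, e)"])
       (use finE in \<open>auto simp: insert_absorb card_insert_if\<close>)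
  also have "\<dots> = (\<Sum>E\<in>?L j. \<Sum>e\<in>K - E. h E)"
    using fin assms(1) by (intro sum.Sigma[symmetric]) auto
  also have "\<dots> = (\<Sum>E\<in>?L j. real (card K - j) * h E)"
    using finE by (intro sum.cong) (auto simp: card_Diff_subset)
  also have "\<dots> = real (card K - j) * (\<Sum>E\<in>?L j. h E)"
    by (simp add: sum_distrib_left)
  finally have le: "Suc j * (\<Sum>E\<in>?L (Suc j). h E) \<le> real (card K - j) * (\<Sum>E\<in>?L j. h E)" .
  have "Suc j * (card K choose Suc j) = (card K - j) * (card K choose j)"
    using assms(2) by (metis binomial_absorb_comp binomial_absorption mult.commute)
  then have b: "real (Suc j) * real (card K choose Suc j) = real (card K - j) * real (card K choose j)"
    by (metis of_nat_mult)
  have pos: "0 < real (card K - j)" "0 < real (card K choose j)" "0 < real (card K choose Suc j)"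
    using assms(2) by auto
  have "level_avg K h (Suc j)
      = (Suc j * (\<Sum>E\<in>?L (Suc j). h E)) / (Suc j * real (card K choose Suc j))"
    by (simp add: level_avg_def)
  also have "\<dots> \<le> (real (card K - j) * (\<Sum>E\<in>?L j. h E)) / (Suc j * real (card K choose Suc j))"
    by (intro divide_right_mono le) simp
  also have "\<dots> = level_avg K h j"
    unfolding b using pos by (simp add: level_avg_def)
  finally show ?thesis .
qed

lemma level_avg_antimono:
  assumes "finite K" "i \<le> j" "j \<le> card K"
    and anti: "\<And>E e. E \<subseteq> K \<Longrightarrow> e \<in> K \<Longrightarrow> h (insert e E) \<le> h E"
  shows "level_avg K h j \<le> level_avg K h i"
  using assms(2,3)
proof (induction j rule: dec_induct)
  case (step j)
  then have "level_avg K h (Suc j) \<le> level_avg K h j"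
    using assms by (intro level_avg_Suc_le) auto
  with step show ?case by linarith
qed simp

lemma binom_expect_level_avg:
  assumes "finite K"
  shows "binom_expect p K h = binom_expect p K (\<lambda>E. level_avg K h (card E))"
proof -
  let ?L = "\<lambda>j. {E \<in> Pow K. card E = j}"
  have group: "binom_expect p K f = (\<Sum>j\<in>{..card K}. p ^ j * (1 - p) ^ (card K - j) * sum f (?L j))" for f
  proof -
    have "binom_expect p K f =
        (\<Sum>j\<in>{..card K}. \<Sum>E\<in>?L j. p ^ card E * (1 - p) ^ card (K - E) * f E)"
      unfolding binom_expect_def using assms
      by (intro sum.group[symmetric]) (auto intro: card_mono)
    also have "\<dots> = (\<Sum>j\<in>{..card K}. p ^ j * (1 - p) ^ (card K - j) * sum f (?L j))"
      unfolding sum_distrib_left using assms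
      by (intro sum.cong refl) (auto simp: card_Diff_subset finite_subset)
    finally show ?thesis .
  qed
  have "(\<Sum>E\<in>?L j. level_avg K h (card E)) = sum h (?L j)" if "j \<le> card K" for j
  proof -
    have "(\<Sum>E\<in>?L j. level_avg K h (card E)) = (card K choose j) * level_avg K h j"
      using n_subsets[OF assms, of j] by (simp add: Pow_def)
    then show ?thesis using that by (simp add: level_avg_def Pow_def)
  qed
  then show ?thesis
    unfolding group by (intro sum.cong) auto
qed

text \<open>If the mean size of the binomial set is at most \<open>m / 2\<close>, then by Markov's inequality its size is at most
\<open>m\<close> with probability at least \<open>1 / 2\<close>, and smaller sets have larger averages of \<open>h\<close>. The proof bounds
the average at size \<open>j\<close> from below by the linear function \<open>a - a / (m + 1) * j\<close> of \<open>j\<close>, which is at most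
\<open>a\<close> for all \<open>j\<close> and at most \<open>0\<close> beyond \<open>m\<close>.\<close>
theorem level_avg_le_binom_expect:
  fixes p :: real
  assumes K: "finite K" "m \<le> card K" and p: "0 \<le> p" "p \<le> 1" "2 * p * card K \<le> m"
    and nonneg: "\<And>E. 0 \<le> h E"
    and anti: "\<And>E e. E \<subseteq> K \<Longrightarrow> e \<in> K \<Longrightarrow> h (insert e E) \<le> h E"
  shows "level_avg K h m \<le> 2 * binom_expect p K h"
proof -
  define a where "a = level_avg K h m"
  have a0: "0 \<le> a" by (auto simp: a_def level_avg_def intro!: divide_nonneg_nonneg sum_nonneg nonneg)
  have mean: "binom_expect p K (\<lambda>E. real (card E)) = p * card K"
    using binom_expect_sum_members[OF K(1), of p "\<lambda>_. 1"] by simp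
  have "a / 2 \<le> a - a * (p * card K / (Suc m))"
  proof -
    have "p * card K / (Suc m) \<le> 1 / 2" using p by (simp add: field_simps)
    then have "a * (p * card K / (Suc m)) \<le> a * (1 / 2)" using a0 by (intro mult_left_mono)
    then show ?thesis by simp
  qed
  also have "\<dots> = binom_expect p K (\<lambda>E. a - a / Suc m * real (card E))"
    unfolding binom_expect_diff binom_expect_cmult mean using K(1) by simp
  also have "\<dots> \<le> binom_expect p K (\<lambda>E. level_avg K h (card E))"
  proof (intro binom_expect_mono p)
    fix E assume E: "E \<subseteq> K"
    show "a - a / Suc m * real (card E) \<le> level_avg K h (card E)"
    proof (cases "card E \<le> m")
      case True
      then have "a \<le> level_avg K h (card E)"
        unfolding a_def using K anti by (intro level_avg_antimono)
      with a0 show ?thesis by (smt (verit) divide_nonneg_nonneg mult_nonneg_nonneg of_nat_0_le_iff)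
    next
      case False
      then have "1 * a \<le> (card E / Suc m) * a" using a0 by (intro mult_right_mono) auto
      moreover have "0 \<le> level_avg K h (card E)"
        by (auto simp: level_avg_def intro!: divide_nonneg_nonneg sum_nonneg nonneg)
      ultimately show ?thesis by (simp add: mult.commute)
    qed
  qed
  also have "\<dots> = binom_expect p K h"
    using binom_expect_level_avg[OF K(1)] by simp
  finally show ?thesis by (simp add: a_def)
qed

section \<open>Rainbow perfect matchings form a spread family\<close>

lemma permutes_restrict_invariant:
  assumes "\<rho> permutes U" "\<rho> ` A = A"
  shows "(\<lambda>x. if x \<in> A then \<rho> x else x) permutes A"
proof (rule bij_imp_permutes)
  have "inj_on (\<lambda>x. if x \<in> A then \<rho> x else x) A"
    using permutes_inj_on[OF assms(1), of A] by (simp add: inj_on_def)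
  then show "bij_betw (\<lambda>x. if x \<in> A then \<rho> x else x) A A"
    using assms(2) by (simp add: bij_betw_def)
qed simp

text \<open>A permutation that maps each block to itself splits into permutations of the blocks, with \<open>fact k\<close>
choices each, and a permutation of the remaining points.\<close>
lemma card_permutes_preserving_blocks:
  assumes "finite C" "finite U"
    and "\<And>c. c \<in> C \<Longrightarrow> B c \<subseteq> U" "\<And>c. c \<in> C \<Longrightarrow> card (B c) = k" "disjoint_family_on B C"
  shows "card {\<rho>. \<rho> permutes U \<and> (\<forall>c\<in>C. \<rho> ` B c = B c)} \<le> fact k ^ card C * fact (card U - k * card C)"
  using assms
proof (induction C arbitrary: U rule: finite_induct)
  case empty
  then show ?case by (simp add: card_permutations)
next
  case (insert c C)
  define U' where "U' = U - B c"
  let ?R = "\<lambda>\<rho> A x. if x \<in> A then \<rho> x else x"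
  let ?S = "{\<rho>. \<rho> permutes U \<and> (\<forall>d\<in>insert c C. \<rho> ` B d = B d)}"
  let ?S' = "{\<rho>. \<rho> permutes U' \<and> (\<forall>d\<in>C. \<rho> ` B d = B d)}"
  have Bc: "B c \<subseteq> U" "card (B c) = k" "finite (B c)"
    using insert.prems by (auto intro: finite_subset)
  have disj: "B d \<inter> B c = {}" if "d \<in> C" for d
    using insert.prems(4) insert.hyps(2) that by (auto simp: disjoint_family_on_def)
  have sub: "B d \<subseteq> U'" if "d \<in> C" for d
    using disj[OF that] insert.prems(2)[of d] that by (auto simp: U'_def)
  have cU': "card U' = card U - k"
    using Bc insert.prems(1) by (simp add: U'_def card_Diff_subset)
  have IH: "card ?S' \<le> fact k ^ card C * fact (card U' - k * card C)"
    using insert.prems sub by (intro insert.IH) (auto simp: U'_def disjoint_family_on_def)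
  define \<phi> where "\<phi> \<rho> = (?R \<rho> (B c), ?R \<rho> U')" for \<rho>
  have "inj_on \<phi> ?S"
  proof (rule inj_onI, rule ext)
    fix \<rho> \<rho>' x assume *: "\<rho> \<in> ?S" "\<rho>' \<in> ?S" "\<phi> \<rho> = \<phi> \<rho>'"
    then have "?R \<rho> (B c) = ?R \<rho>' (B c)" "?R \<rho> U' = ?R \<rho>' U'"
      unfolding \<phi>_def by (simp_all only: prod.inject)
    from fun_cong[OF this(1), of x] fun_cong[OF this(2), of x]
    have eq: "?R \<rho> (B c) x = ?R \<rho>' (B c) x" "?R \<rho> U' x = ?R \<rho>' U' x" .
    show "\<rho> x = \<rho>' x"
    proof (cases "x \<in> U")
      case True
      with eq show ?thesis by (auto simp: U'_def split: if_splits)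
    next
      case False
      with * have "\<rho> x = x" "\<rho>' x = x" by (auto intro: permutes_not_in)
      then show ?thesis by simp
    qed
  qed
  moreover have "\<phi> ` ?S \<subseteq> {\<rho>. \<rho> permutes B c} \<times> ?S'"
  proof (rule image_subsetI)
    fix \<rho> assume \<rho>: "\<rho> \<in> ?S"
    then have p: "\<rho> permutes U" and inv: "\<rho> ` B c = B c" "\<forall>d\<in>C. \<rho> ` B d = B d" by auto
    have "\<rho> ` U' = U'"
      unfolding U'_def image_set_diff[OF permutes_inj[OF p]] permutes_image[OF p] inv(1) ..
    then have "?R \<rho> U' permutes U'" by (rule permutes_restrict_invariant[OF p])
    moreover have "?R \<rho> (B c) permutes B c" by (rule permutes_restrict_invariant[OF p inv(1)])
    moreover have "?R \<rho> U' ` B d = B d" if "d \<in> C" for d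
    proof -
      have "?R \<rho> U' ` B d = \<rho> ` B d" using sub[OF that] by (intro image_cong) auto
      with inv that show ?thesis by simp
    qed
    ultimately show "\<phi> \<rho> \<in> {\<rho>. \<rho> permutes B c} \<times> ?S'" by (auto simp: \<phi>_def)
  qed
  moreover have "finite ({\<rho>. \<rho> permutes B c} \<times> ?S')"
    using Bc(3) insert.prems(1) by (auto simp: U'_def finite_permutations)
  ultimately have "card ?S \<le> card ({\<rho>. \<rho> permutes B c} \<times> ?S')"
    by (rule card_inj_on_le)
  also have "\<dots> = fact k * card ?S'"
    using Bc by (simp add: card_cartesian_product card_permutations)
  also have "\<dots> \<le> fact k * (fact k ^ card C * fact (card U' - k * card C))"
    using IH by (intro mult_left_mono) auto
  finally show ?case
    using insert.hyps cU' by (simp add: algebra_simps)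
qed

lemma power_self_le_exp_fact: "real s ^ s \<le> exp (real s) * fact s"
proof -
  have "(\<Sum>i\<in>{s}. real s ^ i /\<^sub>R fact i) \<le> exp (real s)"
    unfolding exp_def by (intro sum_le_suminf summable_exp_generic) auto
  then show ?thesis by (simp add: field_simps)
qed

lemma fact_diff_le:
  assumes "s \<le> N" "0 < N"
  shows "(fact (N - s) :: real) \<le> fact N * (exp 1 / N) ^ s"
proof (cases "s = 0")
  case False
  have "(real N / real s) ^ s * (real s ^ s) \<le> real (N choose s) * (exp (real s) * fact s)"
    using assms by (intro mult_mono binomial_ge_n_over_k_pow_k power_self_le_exp_fact) auto
  then have "real N ^ s \<le> real (N choose s) * fact s * exp 1 ^ s"
    using False by (simp add: power_divide exp_of_nat_mult[symmetric] mult_ac)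
  then have "real N ^ s * fact (N - s) \<le> (real (N choose s) * fact s * exp 1 ^ s) * fact (N - s)"
    by (intro mult_right_mono) auto
  also have "\<dots> = exp 1 ^ s * fact N"
    using arg_cong[OF binomial_fact_lemma[OF assms(1)], of real] by (simp add: mult_ac)
  finally show ?thesis
    using assms by (simp add: power_divide field_simps)
qed simp

text \<open>The blocks with indices \<open>1, ..., n\<close> partition \<open>{1..k * n}\<close> into consecutive intervals of length \<open>k\<close>.\<close>
definition block :: "nat \<Rightarrow> nat \<Rightarrow> nat set" where
  "block k i = {k * (i - 1) <.. k * i}"

lemma card_block: "i \<ge> 1 \<Longrightarrow> card (block k i) = k"
  by (cases i) (auto simp: block_def)

lemma block_iff:
  assumes "i \<ge> 1" "k \<ge> 1"
  shows "x \<in> block k i \<longleftrightarrow> x \<ge> 1 \<and> (x - 1) div k = i - 1"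
proof -
  obtain j where i: "i = Suc j" using assms by (cases i) auto
  show ?thesis
  proof (cases x)
    case (Suc y)
    have div: "k * j \<le> y \<and> y < k * Suc j \<longleftrightarrow> y div k = j"
    proof
      assume "k * j \<le> y \<and> y < k * Suc j"
      then show "y div k = j" by (intro div_nat_eqI) (auto simp: mult.commute)
    next
      assume eq: "y div k = j"
      show "k * j \<le> y \<and> y < k * Suc j"
        unfolding eq[symmetric] using dividend_less_times_div[of k y] assms(2) by simp
    qed
    have "x \<in> block k i \<longleftrightarrow> k * j \<le> y \<and> y < k * Suc j"
      by (simp add: block_def i Suc less_Suc_eq_le Suc_le_eq)
    with div show ?thesis by (simp add: i Suc)
  qed (simp add: block_def)
qed

lemma block_disjoint: "k \<ge> 1 \<Longrightarrow> disjoint_family_on (block k) {1..n}"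
  by (auto simp: disjoint_family_on_def block_iff)

lemma Union_block:
  assumes "k \<ge> 1"
  shows "(\<Union>i\<in>{1..n}. block k i) = {1..k * n}"
proof (induction n)
  case (Suc n)
  have "{1..Suc n} = insert (Suc n) {1..n}" by auto
  then have "(\<Union>i\<in>{1..Suc n}. block k i) = block k (Suc n) \<union> {1..k * n}"
    using Suc by simp
  also have "\<dots> = {1..k * Suc n}" by (auto simp: block_def)
  finally show ?case .
qed simp

text \<open>The rainbow perfect matchings as sets of (edge, colour) pairs, parametrised by permutations: the
image of the \<open>i\<close>-th block is an edge with colour \<open>i\<close>. Each matching arises from the same number
\<open>fact k ^ n\<close> of permutations, so counting permutations instead of matchings only rescales all counts.\<close>
definition coloured_matching :: "nat \<Rightarrow> nat \<Rightarrow> (nat \<Rightarrow> nat) \<Rightarrow> (nat set \<times> nat) set" where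
  "coloured_matching k n \<pi> = (\<lambda>i. (\<pi> ` block k i, i)) ` {1..n}"

lemma card_coloured_matching: "card (coloured_matching k n \<pi>) = n"
  unfolding coloured_matching_def by (subst card_image) (auto simp: inj_on_def)

lemma coloured_matching_subset:
  assumes "\<pi> permutes {1..k * n}" "k \<ge> 1"
  shows "coloured_matching k n \<pi> \<subseteq> k_subsets (k * n) k \<times> {1..n}"
proof -
  have "\<pi> ` block k i \<in> k_subsets (k * n) k" if "i \<in> {1..n}" for i
  proof -
    have "block k i \<subseteq> {1..k * n}" using Union_block[OF assms(2), of n] that by blast
    then have "\<pi> ` block k i \<subseteq> {1..k * n}" using permutes_image[OF assms(1)] by blast
    moreover have "card (\<pi> ` block k i) = k"
      using that card_block[of i k] permutes_inj_on[OF assms(1)] by (simp add: card_image)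
    ultimately show ?thesis by (simp add: k_subsets_def)
  qed
  then show ?thesis by (auto simp: coloured_matching_def)
qed

lemma inj_on_fst_coloured_matching:
  assumes "\<pi> permutes {1..k * n}" "k \<ge> 1"
  shows "inj_on fst (coloured_matching k n \<pi>)"
proof -
  have "i = j" if "i \<in> {1..n}" "j \<in> {1..n}" "\<pi> ` block k i = \<pi> ` block k j" for i j
  proof (rule ccontr)
    assume "i \<noteq> j"
    have "block k i = block k j"
      using that(3) permutes_inj[OF assms(1)] by (simp add: inj_image_eq_iff)
    moreover have "block k i \<inter> block k j = {}"
      using block_disjoint[OF assms(2), of n] that \<open>i \<noteq> j\<close> by (auto simp: disjoint_family_on_def)
    ultimately have "card (block k i) = 0" by simp
    then show False using card_block[of i k] that assms(2) by simp
  qed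
  then show ?thesis by (auto simp: coloured_matching_def inj_on_def)
qed

text \<open>If \<open>\<pi>\<^sub>0\<close> realises the pairs in \<open>T\<close>, then a permutation \<open>\<pi>\<close> does so exactly if \<open>\<pi>\<close> and \<open>\<pi>\<^sub>0\<close> agree on the
images of the \<open>card T\<close> blocks whose indices are the colours in \<open>T\<close>; equivalently,
\<open>inv \<pi>\<^sub>0 \<circ> \<pi>\<close> preserves these blocks. With \<open>t = card T\<close> this leaves at most
\<open>fact k ^ t * fact (k * n - k * t)\<close> permutations.\<close>
theorem coloured_matchings_spread:
  assumes k: "k \<ge> 1" and n: "n \<ge> 1"
  shows "real (card {\<pi> \<in> {\<pi>. \<pi> permutes {1..k * n}}. T \<subseteq> coloured_matching k n \<pi>})
           \<le> fact (k * n) * (fact k * (exp 1 / real (k * n)) ^ k) ^ card T"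
proof (cases "\<exists>\<pi>. \<pi> permutes {1..k * n} \<and> T \<subseteq> coloured_matching k n \<pi>")
  case True
  then obtain \<pi>\<^sub>0 where \<pi>0: "\<pi>\<^sub>0 permutes {1..k * n}" "T \<subseteq> coloured_matching k n \<pi>\<^sub>0" by auto
  define C where "C = snd ` T"
  have C: "C \<subseteq> {1..n}"
    using \<pi>0(2) by (auto simp: C_def coloured_matching_def)
  then have finC: "finite C" by (rule finite_subset) simp
  have "inj_on snd (coloured_matching k n \<pi>\<^sub>0)"
    by (auto simp: coloured_matching_def inj_on_def)
  then have "inj_on snd T"
    using \<pi>0(2) by (rule inj_on_subset)
  then have cC: "card C = card T" by (simp add: C_def card_image)
  have le: "k * card T \<le> k * n"
    using C card_mono[of "{1..n}" C] cC by simp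
  let ?S = "{\<pi> \<in> {\<pi>. \<pi> permutes {1..k * n}}. T \<subseteq> coloured_matching k n \<pi>}"
  let ?Q = "{\<rho>. \<rho> permutes {1..k * n} \<and> (\<forall>c\<in>C. \<rho> ` block k c = block k c)}"
  have img: "\<pi> ` block k c = \<pi>\<^sub>0 ` block k c" if "\<pi> \<in> ?S" "c \<in> C" for \<pi> c
  proof -
    from that(2) obtain f where f: "(f, c) \<in> T" by (auto simp: C_def)
    with that(1) \<pi>0(2) have "(f, c) \<in> coloured_matching k n \<pi>" "(f, c) \<in> coloured_matching k n \<pi>\<^sub>0"
      by auto
    then show ?thesis by (auto simp: coloured_matching_def)
  qed
  have into: "(\<lambda>\<pi>. inv \<pi>\<^sub>0 \<circ> \<pi>) ` ?S \<subseteq> ?Q"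
  proof (rule image_subsetI)
    fix \<pi> assume \<pi>: "\<pi> \<in> ?S"
    have "(inv \<pi>\<^sub>0 \<circ> \<pi>) ` block k c = block k c" if "c \<in> C" for c
      by (simp only: image_comp[symmetric] img[OF \<pi> that] image_inv_f_f[OF permutes_inj[OF \<pi>0(1)]])
    then show "inv \<pi>\<^sub>0 \<circ> \<pi> \<in> ?Q"
      using \<pi> \<pi>0(1) by (auto intro: permutes_compose permutes_inv)
  qed
  have inj: "inj_on (\<lambda>\<pi>. inv \<pi>\<^sub>0 \<circ> \<pi>) ?S"
  proof (rule inj_onI)
    fix \<pi> \<pi>' assume "inv \<pi>\<^sub>0 \<circ> \<pi> = inv \<pi>\<^sub>0 \<circ> \<pi>'"
    then have "(\<pi>\<^sub>0 \<circ> inv \<pi>\<^sub>0) \<circ> \<pi> = (\<pi>\<^sub>0 \<circ> inv \<pi>\<^sub>0) \<circ> \<pi>'" by (simp only: comp_assoc)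
    then show "\<pi> = \<pi>'"
      by (simp only: permutes_inv_o[OF \<pi>0(1)] id_comp)
  qed
  have "finite ?Q"
    by (rule finite_subset[OF _ finite_permutations[of "{1..k * n}"]]) auto
  from card_inj_on_le[OF inj into this] have "card ?S \<le> card ?Q" .
  also have "\<dots> \<le> fact k ^ card C * fact (card {1..k * n} - k * card C)"
  proof (rule card_permutes_preserving_blocks)
    show "block k c \<subseteq> {1..k * n}" if "c \<in> C" for c
      using Union_block[OF k, of n] C that by blast
    show "card (block k c) = k" if "c \<in> C" for c
      using C that by (intro card_block) auto
    show "disjoint_family_on (block k) C"
      using block_disjoint[OF k] C by (rule disjoint_family_on_mono[rotated])
  qed (use finC in auto)
  finally have "real (card ?S) \<le> real (fact k ^ card T * fact (k * n - k * card T))"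
    unfolding cC by (simp only: of_nat_le_iff card_atLeastAtMost) simp
  also have "\<dots> = fact k ^ card T * fact (k * n - k * card T)" by simp
  also have "\<dots> \<le> fact k ^ card T * (fact (k * n) * (exp 1 / real (k * n)) ^ (k * card T))"
    using le k n fact_diff_le[OF le] by (intro mult_left_mono) auto
  also have "\<dots> = fact (k * n) * (fact k * (exp 1 / real (k * n)) ^ k) ^ card T"
    by (simp add: power_mult_distrib power_mult)
  finally show ?thesis .
next
  case False
  then have "{\<pi> \<in> {\<pi>. \<pi> permutes {1..k * n}}. T \<subseteq> coloured_matching k n \<pi>} = {}" by auto
  then show ?thesis by (simp only: card.empty) simp
qed

lemma has_rainbow_perfect_matchingI:
  assumes \<pi>: "\<pi> permutes {1..k * n}" and k: "k \<ge> 1"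
    and sub: "coloured_matching k n \<pi> \<subseteq> (\<lambda>e. (e, c e)) ` E"
  shows "has_rainbow_perfect_matching (k * n) (E, c)"
proof -
  define M where "M = (\<lambda>i. \<pi> ` block k i) ` {1..n}"
  have col: "\<pi> ` block k i \<in> E \<and> c (\<pi> ` block k i) = i" if "i \<in> {1..n}" for i
  proof -
    have "(\<pi> ` block k i, i) \<in> coloured_matching k n \<pi>"
      using that by (auto simp: coloured_matching_def)
    with sub show ?thesis by auto
  qed
  have "\<Union>M = \<pi> ` (\<Union>i\<in>{1..n}. block k i)" by (auto simp: M_def)
  then have "\<Union>M = {1..k * n}"
    unfolding Union_block[OF k] by (simp only: permutes_image[OF \<pi>])
  moreover have "\<pi> ` block k i \<inter> \<pi> ` block k j = {}" if "i \<in> {1..n}" "j \<in> {1..n}" "i \<noteq> j" for i j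
  proof -
    have "block k i \<inter> block k j = {}"
      using block_disjoint[OF k, of n] that by (auto simp: disjoint_family_on_def)
    then show ?thesis
      using permutes_inj[OF \<pi>] by (metis image_Int image_empty)
  qed
  then have "disjoint M"
    unfolding M_def disjoint_def by fast
  moreover have "M \<subseteq> E" "inj_on c M"
    using col by (auto simp: M_def inj_on_def)
  ultimately show ?thesis
    by (auto simp: has_rainbow_perfect_matching_def perfect_matching_def rainbow_def)
qed

definition avoids_matchings :: "nat \<Rightarrow> nat \<Rightarrow> (nat set \<times> nat) set \<Rightarrow> real" where
  "avoids_matchings k n Y =
     of_bool (\<not> (\<exists>\<pi>\<in>{\<pi>. \<pi> permutes {1..k * n}}. coloured_matching k n \<pi> \<subseteq> Y))"

lemma prob_rainbow_ge_level_avg: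
  assumes k: "k \<ge> 1" and n: "n > 0" and m: "m \<le> card (k_subsets (k * n) k)"
  shows "1 - level_avg (k_subsets (k * n) k) (\<lambda>E. colour_expect n E (avoids_matchings k n)) m
       \<le> measure_pmf.prob (random_coloured_hypergraph n (k * n) m k)
            {H. has_rainbow_perfect_matching (k * n) H}"
proof -
  define K where "K = k_subsets (k * n) k"
  have finK: "finite K" by (simp add: K_def k_subsets_def)
  define g where "g = avoids_matchings k n"
  let ?L = "{E. E \<subseteq> K \<and> card E = m}"
  let ?P = "\<lambda>E. Pi_pmf E 0 (\<lambda>_. pmf_of_set {1..n})"
  let ?G = "{H. has_rainbow_perfect_matching (k * n) H}"
  have cardL: "card ?L = card K choose m" using finK by (rule n_subsets)
  obtain E\<^sub>0 where "E\<^sub>0 \<subseteq> K" "card E\<^sub>0 = m"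
    using m by (metis K_def obtain_subset_with_card_n)
  then have L: "?L \<noteq> {}" "finite ?L" using finK by auto
  have finE: "finite E" if "E \<in> ?L" for E using that finK by (auto intro: finite_subset)
  have ge: "1 - colour_expect n E g \<le> measure_pmf.expectation (map_pmf (Pair E) (?P E)) (indicator ?G)"
    if E: "E \<in> ?L" for E
  proof -
    note int = integrable_measure_pmf_finite[OF finite_set_Pi_pmf_colours[OF finE[OF E] n]]
    have "1 - colour_expect n E g = measure_pmf.expectation (?P E) (\<lambda>c. 1 - g ((\<lambda>e. (e, c e)) ` E))"
      unfolding colour_expect_def
      by (subst Bochner_Integration.integral_diff[OF int int]) simp
    also have "\<dots> \<le> measure_pmf.expectation (?P E) (\<lambda>c. indicator ?G (E, c))"
    proof (intro integral_mono int)
      fix c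
      show "1 - g ((\<lambda>e. (e, c e)) ` E) \<le> (indicator ?G (E, c) :: real)"
        using has_rainbow_perfect_matchingI[OF _ k, of _ n c E]
        by (auto simp: g_def avoids_matchings_def indicator_def)
    qed
    finally show ?thesis by (simp only: integral_map_pmf)
  qed
  have "1 - level_avg K (\<lambda>E. colour_expect n E g) m = (\<Sum>E\<in>?L. (1 - colour_expect n E g) / card ?L)"
    using L by (simp add: level_avg_def cardL[symmetric] sum_divide_distrib[symmetric] sum_subtractf
        diff_divide_distrib)
  also have "\<dots> \<le> (\<Sum>E\<in>?L. measure_pmf.expectation (map_pmf (Pair E) (?P E)) (indicator ?G) /\<^sub>R card ?L)"
  proof (intro sum_mono)
    fix E assume "E \<in> ?L"
    from divide_right_mono[OF ge[OF this], of "card ?L"]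
    show "(1 - colour_expect n E g) / card ?L
        \<le> measure_pmf.expectation (map_pmf (Pair E) (?P E)) (indicator ?G) /\<^sub>R card ?L"
      by (simp add: divide_inverse mult.commute)
  qed
  also have "\<dots> = measure_pmf.expectation (pmf_of_set ?L \<bind> (\<lambda>E. map_pmf (Pair E) (?P E))) (indicator ?G)"
    using L finite_set_Pi_pmf_colours[OF finE n]
    by (intro pmf_expectation_bind_pmf_of_set[symmetric]) auto
  also have "pmf_of_set ?L \<bind> (\<lambda>E. map_pmf (Pair E) (?P E)) = random_coloured_hypergraph n (k * n) m k"
    by (simp add: random_coloured_hypergraph_def K_def map_pmf_def)
  finally show ?thesis by (simp add: K_def g_def)
qed

section \<open>Choice of the round densities\<close>

text \<open>The three reductions combined: edge sets of size \<open>m\<close> are compared with binomial edge sets of density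
\<open>q\<close>, these with independent coloured edges of density \<open>q / n\<close>, and the latter cover a rainbow perfect
matching by the spread lemma, since the rounds have total density at most \<open>q / n\<close>.\<close>
lemma prob_rainbow_lower_bound:
  fixes \<sigma> q :: real and p :: "nat \<Rightarrow> real"
  assumes k: "k \<ge> 1" and n: "n \<ge> 1"
  defines "\<sigma> \<equiv> fact k * (exp 1 / real (k * n)) ^ k"
  defines "K \<equiv> k_subsets (k * n) k"
  assumes l: "n < 2 ^ l" and p: "\<And>j. j < l \<Longrightarrow> \<sigma> \<le> p j" "\<And>j. j < l \<Longrightarrow> p j \<le> 1"
    and q: "q \<le> 1" "(\<Sum>j<l. p j) \<le> q / n" and m: "m \<le> card K" "2 * q * card K \<le> m"
  shows "1 - 2 * (\<Sum>j<l. (4 * \<sigma> / p j) ^ (2 ^ j))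
           \<le> measure_pmf.prob (random_coloured_hypergraph n (k * n) m k)
                {H. has_rainbow_perfect_matching (k * n) H}"
proof -
  define g where "g = avoids_matchings k n"
  define h where "h E = colour_expect n E g" for E
  define X where "X = K \<times> {1..n}"
  define J where "J = {\<pi>. \<pi> permutes {1..k * n}}"
  define r where "r = 1 - (\<Prod>j<l. 1 - p j)"
  let ?\<epsilon> = "\<Sum>j<l. (4 * \<sigma> / p j) ^ (2 ^ j)"
  have \<sigma>: "0 < \<sigma>" using k n by (simp add: \<sigma>_def)
  have finK: "finite K" by (simp add: K_def k_subsets_def)
  have p0: "0 \<le> p j" if "j < l" for j using p(1)[OF that] \<sigma> by simp
  have "0 \<le> (\<Sum>j<l. p j)" using p0 by (intro sum_nonneg) auto
  then have qn: "0 \<le> q / n" using q by linarith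
  then have q0: "0 \<le> q" using n by (simp add: zero_le_divide_iff)
  have qn1: "q / n \<le> 1" using q n by (simp add: field_simps)
  have r0: "0 \<le> r" unfolding r_def using p0 p(2) by (auto intro!: prod_le_1)
  have r1: "r \<le> q / n"
    using Weierstrass_prod_ineq[of "{..<l}" p] p0 p(2) q(2) by (simp add: r_def)
  have g_anti: "antimono g"
    by (rule antimonoI) (auto simp: g_def avoids_matchings_def)
  have cardJ: "card J = fact (k * n)"
    unfolding J_def by (rule card_permutations) auto
  have "real (card J) * binom_expect r X g \<le> fact (k * n) * ?\<epsilon>"
    unfolding r_def g_def avoids_matchings_def J_def[symmetric]
  proof (rule spread_family_covered)
    show "finite X" "finite J" by (auto simp: X_def J_def finK finite_permutations)
    show "coloured_matching k n \<pi> \<subseteq> X" if "\<pi> \<in> J" for \<pi>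
      using coloured_matching_subset[OF _ k] that by (simp add: J_def X_def K_def)
    show "card (coloured_matching k n \<pi>) < 2 ^ l" for \<pi>
      using l by (simp add: card_coloured_matching)
    show "real (card {i \<in> J. T \<subseteq> coloured_matching k n i}) \<le> fact (k * n) * \<sigma> ^ card T" for T
      unfolding J_def \<sigma>_def by (rule coloured_matchings_spread[OF k n])
  qed (use p \<sigma> in auto)
  then have "binom_expect r X g \<le> ?\<epsilon>"
    by (simp add: cardJ)
  moreover have "binom_expect (q / n) X g \<le> binom_expect r X g"
    using finK r0 r1 qn1 g_anti by (intro binom_expect_antimono_prob) (auto simp: X_def)
  moreover have "binom_expect q K h \<le> binom_expect (q / n) X g"
    unfolding h_def X_def
  proof (rule random_colours_dominate[OF finK _ q0 q(1)])
    have "subadditive_per_edge (\<lambda>Y. of_bool (\<not> (\<exists>S\<in>coloured_matching k n ` J. S \<subseteq> Y)))"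
      using inj_on_fst_coloured_matching[OF _ k] by (intro subadditive_per_edge_avoid) (auto simp: J_def)
    then show "subadditive_per_edge g" by (simp add: g_def avoids_matchings_def[abs_def] J_def)
  qed (use n in auto)
  moreover have "level_avg K h m \<le> 2 * binom_expect q K h"
  proof (rule level_avg_le_binom_expect[OF finK m(1) q0 q(1) m(2)])
    fix E show "0 \<le> h E"
      by (auto simp: h_def g_def colour_expect_def avoids_matchings_def intro!: integral_nonneg)
  next
    fix E e assume "E \<subseteq> K"
    then show "h (insert e E) \<le> h E"
      unfolding h_def using finite_subset[OF _ finK] n g_anti by (intro colour_expect_insert_mono) auto
  qed
  moreover have "1 - level_avg K h m \<le> measure_pmf.prob (random_coloured_hypergraph n (k * n) m k)
                {H. has_rainbow_perfect_matching (k * n) H}"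
    using prob_rainbow_ge_level_avg[OF k _ m(1)[unfolded K_def]] n unfolding K_def h_def g_def by auto
  ultimately show ?thesis by linarith
qed

lemma sum_half_powers_le_1: "(\<Sum>j<l. (1 / 2 :: real) ^ Suc j) \<le> 1"
proof -
  have "(\<Sum>j<l. (1 / 2 :: real) ^ Suc j) = 1 - (1 / 2) ^ l" by (induction l) auto
  then show ?thesis by simp
qed

text \<open>The estimate behind the choice of the densities in the next lemma: with \<open>x = ln n\<close>, the term
\<open>x / 2 ^ j\<close> contributes, by Bernoulli's inequality, a factor \<open>1 / (1 + x)\<close> that tends to \<open>0\<close> in every
round, even in the last rounds, where only boundedly many elements are left to cover; the leading
\<open>2\<close> makes the errors summable over the rounds.\<close>
lemma round_error_le:
  fixes x :: real
  assumes "0 \<le> x"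
  shows "(1 / (2 * (1 + x / 2 ^ j))) ^ (2 ^ j) \<le> (1 / 2) ^ Suc j * (1 / (1 + x))"
proof -
  have "1 + real (2 ^ j) * (x / 2 ^ j) \<le> (1 + x / 2 ^ j) ^ (2 ^ j)"
    using assms by (intro Bernoulli_inequality) (auto intro: order_trans[of _ 0])
  then have 1: "1 + x \<le> (1 + x / 2 ^ j) ^ (2 ^ j)" by simp
  have "Suc j \<le> 2 ^ j" by (induction j) auto
  then have 2: "(1 / 2 :: real) ^ (2 ^ j) \<le> (1 / 2) ^ Suc j" by (intro power_decreasing) auto
  have "(1 / (2 * (1 + x / 2 ^ j))) ^ (2 ^ j) = (1 / 2) ^ (2 ^ j) * (1 / (1 + x / 2 ^ j) ^ (2 ^ j))"
    by (simp only: power_divide power_mult_distrib power_one times_divide_times_eq mult_1)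
  also have "\<dots> \<le> (1 / 2) ^ Suc j * (1 / (1 + x))"
    using 1 2 assms by (intro mult_mono divide_left_mono) (auto intro!: mult_pos_pos)
  finally show ?thesis .
qed

text \<open>About \<open>log\<^sub>2 n\<close> rounds are needed, and the densities \<open>8 * \<sigma> * (1 + x / 2 ^ j)\<close> with \<open>x = ln n\<close> add up to
at most \<open>40 * \<sigma> * x\<close>, because the second terms form a geometric series. Since \<open>\<sigma>\<close> times the number of
possible edges is at most \<open>exp 1 ^ k\<close>, the \<open>m\<close> available edges pay for this as soon as
\<open>L\<close> is at least \<open>80 * exp 1 ^ k\<close>. The factor \<open>2\<close> from \<open>40\<close> to \<open>80\<close> is the one lost in passing to a
binomial edge set of mean size \<open>m / 2\<close>.\<close>
lemma prob_rainbow_lower_bound_log: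
  fixes L :: real
  assumes k: "k \<ge> 1" and n: "n \<ge> 3" and L: "80 * exp 1 ^ k \<le> L"
  defines "m \<equiv> nat \<lceil>L * real n * ln (real n)\<rceil>"
  assumes m: "m \<le> card (k_subsets (k * n) k)"
  shows "1 - 2 / (1 + ln n)
           \<le> measure_pmf.prob (random_coloured_hypergraph n (k * n) m k)
                {H. has_rainbow_perfect_matching (k * n) H}"
proof -
  define N where "N = card (k_subsets (k * n) k)"
  define \<sigma> :: real where "\<sigma> = fact k * (exp 1 / real (k * n)) ^ k"
  define x where "x = ln (real n)"
  define p where "p j = 8 * \<sigma> * (1 + x / 2 ^ j)" for j :: nat
  define q where "q = m / (2 * real N)"
  have \<sigma>: "0 < \<sigma>" using k n by (simp add: \<sigma>_def)
  have "exp 1 \<le> real n" using exp_le n by linarith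
  then have x: "1 \<le> x" unfolding x_def using n by (simp add: ln_ge_iff)
  have N: "N = k * n choose k"
    unfolding N_def k_subsets_def by (subst n_subsets) auto
  have "k \<le> k * n" using n by simp
  then have N0: "0 < N" unfolding N by simp
  have \<sigma>N: "\<sigma> * N \<le> exp 1 ^ k"
  proof -
    have "real (fact k * N) \<le> real ((k * n) ^ k)"
      unfolding N using binomial_fact_pow[of "k * n" k] by (simp only: of_nat_le_iff mult.commute)
    then have "fact k * real N \<le> real (k * n) ^ k" by simp
    then have "(fact k * real N) * (exp 1 / real (k * n)) ^ k \<le> real (k * n) ^ k * (exp 1 / real (k * n)) ^ k"
      by (intro mult_right_mono) auto
    also have "\<dots> = exp 1 ^ k" using k n by (simp add: power_divide)
    finally show ?thesis by (simp add: \<sigma>_def mult_ac)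
  qed
  obtain t where t: "2 ^ t \<le> n" "n < 2 ^ Suc t"
    using ex_power_ivl1[of 2 n] n by auto
  define l where "l = Suc t"
  have "real (2 ^ t) \<le> real n" using t(1) by (simp only: of_nat_le_iff)
  then have "ln (2 ^ t) \<le> x" unfolding x_def using n by (subst ln_le_cancel_iff) auto
  then have "t * ln 2 \<le> x" by (simp add: ln_realpow)
  moreover have "t * (1 / 2) \<le> t * ln (2 :: real)"
    using ln2_ge_two_thirds by (intro mult_left_mono) auto
  ultimately have l: "l \<le> 3 * x" using x by (simp add: l_def)
  have "(\<Sum>j<l. p j) = 8 * \<sigma> * (l + 2 * x * (\<Sum>j<l. (1 / 2) ^ Suc j))"
    by (simp add: p_def sum_distrib_left sum.distrib power_divide algebra_simps)
  also have "\<dots> \<le> 8 * \<sigma> * (3 * x + 2 * x * 1)"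
    using \<sigma> x l sum_half_powers_le_1[of l] by (intro mult_left_mono add_mono) auto
  also have "\<dots> = 40 * x * \<sigma>" by simp
  also have "\<dots> \<le> q / n"
  proof -
    have "80 * x * n * (\<sigma> * N) \<le> 80 * x * n * exp 1 ^ k"
      using \<sigma>N x by (intro mult_left_mono) auto
    also have "\<dots> = 80 * exp 1 ^ k * (n * x)" by simp
    also have "\<dots> \<le> L * (n * x)"
      using L x by (intro mult_right_mono) auto
    also have "\<dots> \<le> m" unfolding m_def x_def by (simp add: mult.assoc)  linarith
    finally show ?thesis
      using N0 n by (simp add: q_def field_simps)
  qed
  finally have sum_p: "(\<Sum>j<l. p j) \<le> q / n" .
  have q1: "q \<le> 1" using m N0 by (simp add: q_def N_def[symmetric] field_simps)
  have p0: "0 \<le> p j" for j using \<sigma> x by (simp add: p_def)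
  have "p j \<le> 1" if "j < l" for j
  proof -
    have "p j \<le> (\<Sum>j<l. p j)" using that p0 by (intro member_le_sum) auto
    also have "\<dots> \<le> 1 / 1" using sum_p q1 n by (elim order_trans) (intro frac_le, auto)
    finally show ?thesis by simp
  qed
  moreover have "\<sigma> \<le> p j" for j
  proof -
    have "\<sigma> * 1 \<le> \<sigma> * (8 * (1 + x / 2 ^ j))"
      using \<sigma> x by (intro mult_left_mono) (auto intro: add_increasing2)
    then show ?thesis by (simp add: p_def algebra_simps)
  qed
  moreover have "2 * q * N \<le> m" using N0 by (simp add: q_def)
  ultimately have "1 - 2 * (\<Sum>j<l. (4 * \<sigma> / p j) ^ (2 ^ j))
      \<le> measure_pmf.prob (random_coloured_hypergraph n (k * n) m k)
           {H. has_rainbow_perfect_matching (k * n) H}"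
    using k n t(2) q1 sum_p m unfolding \<sigma>_def N_def l_def
    by (intro prob_rainbow_lower_bound[where q = q]) auto
  moreover have "(\<Sum>j<l. (4 * \<sigma> / p j) ^ (2 ^ j)) \<le> 1 / (1 + x)"
  proof -
    have "4 * \<sigma> / (8 * \<sigma> * y) = 1 / (2 * y)" for y
      using \<sigma> by simp
    then have "4 * \<sigma> / p j = 1 / (2 * (1 + x / 2 ^ j))" for j
      by (simp only: p_def)
    then have "(\<Sum>j<l. (4 * \<sigma> / p j) ^ (2 ^ j)) \<le> (\<Sum>j<l. (1 / 2) ^ Suc j * (1 / (1 + x)))"
      using round_error_le[of x] x by (intro sum_mono) simp
    also have "\<dots> = (\<Sum>j<l. (1 / 2) ^ Suc j) * (1 / (1 + x))"
      by (rule sum_distrib_right[symmetric])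
    also have "\<dots> \<le> 1 * (1 / (1 + x))"
      using x by (intro mult_right_mono sum_half_powers_le_1) auto
    finally show ?thesis by simp
  qed
  ultimately show ?thesis unfolding x_def by simp
qed

text \<open>Only the size condition remains: there are at least \<open>n ^ k\<close> possible edges, and \<open>n ^ 2\<close> already exceeds
\<open>L * n * ln n\<close> for large \<open>n\<close>. This is where \<open>k \<ge> 2\<close> enters.\<close>
theorem corollary1p2:
  fixes k :: nat
  assumes "k \<ge> 2"
  shows "\<exists>L\<^sub>0::real. \<forall>L\<ge>L\<^sub>0.
    (\<lambda>n. measure_pmf.prob
            (random_coloured_hypergraph n (k * n) (nat \<lceil>L * real n * ln (real n)\<rceil>) k)
            {H. has_rainbow_perfect_matching (k * n) H}) \<longlonglongrightarrow> 1"
proof (intro exI[of _ "80 * exp 1 ^ k"] allI impI)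
  fix L :: real assume L: "80 * exp 1 ^ k \<le> L"
  have "eventually (\<lambda>n. L * real n * ln (real n) \<le> real n ^ 2) sequentially"
    by real_asymp
  then have size: "eventually (\<lambda>n. nat \<lceil>L * real n * ln (real n)\<rceil> \<le> card (k_subsets (k * n) k)) sequentially"
    using eventually_ge_at_top[of 1]
  proof eventually_elim
    case (elim n)
    have "\<lceil>L * real n * ln (real n)\<rceil> \<le> int (n ^ 2)"
      using elim(1) by (simp add: ceiling_le_iff)
    then have "nat \<lceil>L * real n * ln (real n)\<rceil> \<le> n ^ 2" by linarith
    also have "\<dots> \<le> n ^ k" using assms elim(2) by (intro power_increasing) auto
    also have "n ^ k \<le> k * n choose k"
    proof -
      have "(real (k * n) / real k) ^ k \<le> real (k * n choose k)"
        using elim(2) by (intro binomial_ge_n_over_k_pow_k) auto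
      then have "real (n ^ k) \<le> real (k * n choose k)" using assms by simp
      then show ?thesis by (simp only: of_nat_le_iff)
    qed
    also have "\<dots> = card (k_subsets (k * n) k)"
      unfolding k_subsets_def by (subst n_subsets) auto
    finally show ?case .
  qed
  show "(\<lambda>n. measure_pmf.prob
            (random_coloured_hypergraph n (k * n) (nat \<lceil>L * real n * ln (real n)\<rceil>) k)
            {H. has_rainbow_perfect_matching (k * n) H}) \<longlonglongrightarrow> 1"
  proof (rule tendsto_sandwich)
    show "eventually (\<lambda>n. 1 - 2 / (1 + ln (real n)) \<le> measure_pmf.prob
            (random_coloured_hypergraph n (k * n) (nat \<lceil>L * real n * ln (real n)\<rceil>) k)
            {H. has_rainbow_perfect_matching (k * n) H}) sequentially"
      using size eventually_ge_at_top[of 3]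
    proof eventually_elim
      case (elim n)
      then show ?case using assms L by (intro prob_rainbow_lower_bound_log) auto
    qed
    show "(\<lambda>n. 1 - 2 / (1 + ln (real n))) \<longlonglongrightarrow> 1" by real_asymp
  qed auto
qed

end
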